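(* Let $f$ be any polynomial of degree $d\ge2$ defined over the field $\mathbb{C}((t))$ of formal Laurent series which does not have potential good reduction. Then $f$ admits a rigid repelling periodic point of period $\le2$, and a repelling rigid fixed point if $d\in\{2,3\}$.
   Context: $\mathbb{C}((t))$ is endowed with the $t$-adic norm $|\sum a_nt^n|=e^{-\min\{n:\,a_n\neq0\}}$, which extends uniquely to its algebraic closure $\mathbb{C}\langle\langle t\rangle\rangle$ (Puiseux series) and to the completion $\mathbb{L}$ of the latter, an algebraically closed complete field with residue field $\mathbb{C}$. Rigid points of the Berkovich projective line $\mathbb{P}^{1,\mathrm{an}}_{\mathbb{L}}$ are the points of $\mathbb{P}^1(\mathbb{L})$. A rigid point $z$ with $f^n(z)=z$ is automatically defined over $\mathbb{C}\langle\langle t\rangle\rangle$; it is repelling if its multiplier $\mu=(f^n)'(z)$ satisfies $|\mu|>1$. A rational map $f$ of degree $d$ over $\mathbb{L}$ has good reduction if, writing $f=[P:Q]$ with the maximum of the norms of the coefficients of $P$ and $Q$ equal to $1$, the reduction $[\tilde P:\tilde Q]$ is a rational map of degree $d$ over the residue field $\mathbb{C}$ (equivalently the Gauss point is totally invariant). It has potential good reduction if it is conjugate by an element of $\mathrm{PGL}(2,\mathbb{L})$ to a map having good reduction. *)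

theory Defs
  imports
    "HOL-Analysis.Abstract_Metric_Spaces"
    "HOL-Computational_Algebra.Formal_Laurent_Series"
    "HOL-Algebra.Algebraic_Closure_Type"
begin

text \<open>The norm of \<open>\<complex>((t))\<close> and the completion of its algebraic closure.\<close>

definition fls_abs :: "complex fls \<Rightarrow> real" where
  "fls_abs a = (if a = 0 then 0 else exp (- real_of_int (fls_subdegree a)))"

text \<open>
  The field \<open>\<bbbL>\<close> is determined up to a unique isometric isomorphism over the algebraic closure
  by the following data: a field \<open>'l\<close> with a complete non-Archimedean absolute value \<open>nrm\<close>, and an
  embedding \<open>emb\<close> of the algebraic closure of \<open>\<complex>((t))\<close> with dense image that carries \<open>nrm\<close> to
  an (hence the) extension of the \<open>t\<close>-adic norm.
  That \<open>\<bbbL>\<close> is algebraically closed with residue field \<open>\<complex>\<close> is a consequence, not an axiom.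
\<close>
locale laurent_alg_closure_completion =
  fixes nrm :: "'l :: field \<Rightarrow> real"
    and emb :: "complex fls alg_closure \<Rightarrow> 'l"
  assumes nrm_nonneg: "nrm x \<ge> 0"
    and nrm_eq_0_iff: "nrm x = 0 \<longleftrightarrow> x = 0"
    and nrm_mult: "nrm (x * y) = nrm x * nrm y"
    and nrm_ultrametric: "nrm (x + y) \<le> max (nrm x) (nrm y)"
    and nrm_complete: "Metric_space.mcomplete UNIV (\<lambda>x y. nrm (x - y))"
    and emb_1: "emb 1 = 1"
    and emb_add: "emb (a + b) = emb a + emb b"
    and emb_mult: "emb (a * b) = emb a * emb b"
    and emb_dense: "Metric_space.mtopology UNIV (\<lambda>x y. nrm (x - y)) closure_of range emb = UNIV"
    and nrm_extends: "nrm (emb (to_ac c)) = fls_abs c"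
begin

text \<open>The metric used above satisfies the axioms of a metric space.\<close>
lemma nrm_Metric_space: "Metric_space UNIV (\<lambda>x y. nrm (x - y))"
proof -
  have "nrm (-1) * nrm (-1) = 1"
    using nrm_mult[of "-1" "-1"] nrm_extends[of 1] by (simp add: fls_abs_def emb_1)
  hence one: "nrm (-1) = 1"
    using nrm_nonneg[of "-1"] by (metis abs_of_nonneg abs_square_eq_1 power2_eq_square)
  have sym: "nrm (x - y) = nrm (y - x)" for x y
    using nrm_mult[of "-1" "y - x"] one by simp
  have tri: "nrm (x - z) \<le> nrm (x - y) + nrm (y - z)" for x y z
    using nrm_ultrametric[of "x - y" "y - z"] nrm_nonneg[of "x - y"] nrm_nonneg[of "y - z"]
    by simp
  show ?thesis
    by (rule Metric_space.intro) (rule nrm_nonneg, rule sym, simp add: nrm_eq_0_iff, rule tri)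
qed

end

definition base_change :: "(complex fls alg_closure \<Rightarrow> 'l :: field) \<Rightarrow> complex fls poly \<Rightarrow> 'l poly" where
  "base_change emb f = map_poly (\<lambda>c. emb (to_ac c)) f"

text \<open>
  The reduction map from the valuation ring of \<open>\<bbbL>\<close> to its residue field, the latter being identified
  with \<open>\<complex>\<close> through the constant series.
  It is meaningful on elements of norm at most 1 only.
\<close>
definition reduction :: "('l :: field \<Rightarrow> real) \<Rightarrow> (complex fls alg_closure \<Rightarrow> 'l) \<Rightarrow> 'l \<Rightarrow> complex" where
  "reduction nrm emb x = (THE c. nrm (x - emb (to_ac (fls_const c))) < 1)"

text \<open>
  A rational map \<open>[P:Q]\<close> of degree \<open>d\<close> is given by two binary forms of degree \<open>d\<close> without
  common factor. The form \<open>\<Sum>i\<le>d. p\<^sub>i X\<^sup>i Y\<^sup>d\<^sup>-\<^sup>i\<close> is represented by the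
  univariate polynomial \<open>\<Sum>i\<le>d. p\<^sub>i X\<^sup>i\<close>; the absence of the common factor \<open>Y\<close>
  means that one of the two polynomials has degree exactly \<open>d\<close>.
\<close>
definition rational_map :: "nat \<Rightarrow> 'a :: field poly \<Rightarrow> 'a poly \<Rightarrow> bool" where
  "rational_map d P Q \<longleftrightarrow> coprime P Q \<and> max (degree P) (degree Q) = d"

definition max_coeff_norm :: "('l :: field \<Rightarrow> real) \<Rightarrow> 'l poly \<Rightarrow> 'l poly \<Rightarrow> real" where
  "max_coeff_norm nrm P Q = Max (nrm ` (range (coeff P) \<union> range (coeff Q)))"

definition good_reduction ::
  "('l :: field \<Rightarrow> real) \<Rightarrow> (complex fls alg_closure \<Rightarrow> 'l) \<Rightarrow> nat \<Rightarrow> 'l poly \<Rightarrow> 'l poly \<Rightarrow> bool" where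
  "good_reduction nrm emb d P Q \<longleftrightarrow> rational_map d P Q \<and>
     (\<exists>u. u \<noteq> 0 \<and> max_coeff_norm nrm (smult u P) (smult u Q) = 1 \<and>
          rational_map d (map_poly (reduction nrm emb) (smult u P))
                         (map_poly (reduction nrm emb) (smult u Q)))"

text \<open>
  \<open>form_subst d a b c e P\<close> is the form \<open>P(aX + bY, cX + eY)\<close> of degree \<open>d\<close>, written in the
  coordinate \<open>Y = 1\<close>.
\<close>
definition form_subst :: "nat \<Rightarrow> 'l :: field \<Rightarrow> 'l \<Rightarrow> 'l \<Rightarrow> 'l \<Rightarrow> 'l poly \<Rightarrow> 'l poly" where
  "form_subst d a b c e P = (\<Sum>i\<le>d. smult (coeff P i) ([:b, a:] ^ i * [:e, c:] ^ (d - i)))"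

text \<open>
  The two components of \<open>M\<^sup>-\<^sup>1 \<circ> [P:Q] \<circ> M\<close> for the class in \<open>PGL(2)\<close> of the matrix \<open>M\<close> with
  rows \<open>(a, b)\<close> and \<open>(c, e)\<close>; the inverse is represented by the adjugate matrix.
\<close>
definition conj_num :: "nat \<Rightarrow> 'l :: field \<Rightarrow> 'l \<Rightarrow> 'l \<Rightarrow> 'l \<Rightarrow> 'l poly \<Rightarrow> 'l poly \<Rightarrow> 'l poly" where
  "conj_num d a b c e P Q = smult e (form_subst d a b c e P) - smult b (form_subst d a b c e Q)"

definition conj_den :: "nat \<Rightarrow> 'l :: field \<Rightarrow> 'l \<Rightarrow> 'l \<Rightarrow> 'l \<Rightarrow> 'l poly \<Rightarrow> 'l poly \<Rightarrow> 'l poly" where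
  "conj_den d a b c e P Q = smult a (form_subst d a b c e Q) - smult c (form_subst d a b c e P)"

definition potential_good_reduction ::
  "('l :: field \<Rightarrow> real) \<Rightarrow> (complex fls alg_closure \<Rightarrow> 'l) \<Rightarrow> nat \<Rightarrow> 'l poly \<Rightarrow> 'l poly \<Rightarrow> bool" where
  "potential_good_reduction nrm emb d P Q \<longleftrightarrow>
     (\<exists>a b c e. a * e - b * c \<noteq> 0 \<and>
        good_reduction nrm emb d (conj_num d a b c e P Q) (conj_den d a b c e P Q))"

definition poly_iter :: "'l :: field poly \<Rightarrow> nat \<Rightarrow> 'l poly" where
  "poly_iter f n = (pcompose f ^^ n) [:0, 1:]"

lemma poly_poly_iter: "poly (poly_iter f n) z = (poly f ^^ n) z"
  by (induction n) (simp_all add: poly_iter_def poly_pcompose)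

definition multiplier :: "'l :: field poly \<Rightarrow> nat \<Rightarrow> 'l \<Rightarrow> 'l" where
  "multiplier f n z = poly (pderiv (poly_iter f n)) z"

text \<open>The period is the exact one.\<close>
definition periodic_point :: "'l :: field poly \<Rightarrow> nat \<Rightarrow> 'l \<Rightarrow> bool" where
  "periodic_point f n z \<longleftrightarrow>
     n > 0 \<and> (poly f ^^ n) z = z \<and> (\<forall>m. 0 < m \<and> m < n \<longrightarrow> (poly f ^^ m) z \<noteq> z)"

text \<open>
  Rigid points are the points of \<open>\<bbbP>\<^sup>1(\<bbbL>)\<close>. For a polynomial of degree at least 2 the point at
  infinity is fixed with multiplier 0 and the other rigid periodic points lie in \<open>\<bbbL>\<close>, so
  a repelling one is an element of \<open>\<bbbL>\<close>.
\<close>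
definition repelling_periodic_point :: "('l :: field \<Rightarrow> real) \<Rightarrow> 'l poly \<Rightarrow> nat \<Rightarrow> 'l \<Rightarrow> bool" where
  "repelling_periodic_point nrm f n z \<longleftrightarrow> periodic_point f n z \<and> nrm (multiplier f n z) > 1"

end

theory Submission
  imports Defs
begin

text \<open>
  Everything takes place over the algebraic closure of \<open>\<complex>((t))\<close>. Let \<open>c\<close> be the leading coefficient of
  \<open>f\<close>. If \<open>\<bar>c\<bar> \<bar>x - y\<bar>\<^sup>d\<^sup>-\<^sup>1 \<le> 1\<close> for all fixed points \<open>x\<close>, \<open>y\<close>, then moving \<open>x\<close> to the
  origin and rescaling by \<open>s\<close> with \<open>s\<^sup>d\<^sup>-\<^sup>1 = 1 / c\<close> makes \<open>f\<close> monic with integral coefficients, so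
  the reduction is good. Otherwise choose fixed points \<open>z\<^sub>1\<close>, \<open>z\<^sub>2\<close> at distance \<open>r\<close> with
  \<open>\<bar>c\<bar> r\<^sup>d\<^sup>-\<^sup>1 > 1\<close>, and let \<open>B\<^sub>1\<close>, \<open>B\<^sub>2\<close> be the disjoint open balls of radius \<open>r\<close> around them.

  In residue characteristic 0, an open ball containing \<open>n \<ge> 1\<close> roots of a polynomial contains exactly
  \<open>n - 1\<close> roots of its derivative. If \<open>B\<^sub>1\<close> contains \<open>m\<close> solutions of \<open>f = z\<^sub>1\<close>, it therefore contains \<open>m\<close>
  solutions of \<open>f = z\<^sub>2\<close> and \<open>m - 1\<close> critical points. The largest balls around these \<open>2 m\<close> points which
  do not meet the other fibre are equal or disjoint. If each of them contained at least two points
  of its fibre, at least half as many critical points would lie in them, that is, at least \<open>m\<close>. Hence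
  one of them is mapped injectively, and expanded, onto a ball of radius \<open>r\<close> around \<open>z\<^sub>1\<close> or
  \<open>z\<^sub>2\<close>; likewise in \<open>B\<^sub>2\<close>. Either some \<open>B\<^sub>i\<close> expands over itself, which yields a repelling fixed
  point, or \<open>B\<^sub>1\<close> and \<open>B\<^sub>2\<close> expand over each other, which yields a repelling point of exact period 2.
  For \<open>d \<le> 3\<close>, the multiplier \<open>1 + c \<Prod>\<^sub>j\<^sub>\<noteq>\<^sub>i (z\<^sub>i - z\<^sub>j)\<close> is already large at \<open>z\<^sub>1\<close> or \<open>z\<^sub>2\<close>.
\<close>

section \<open>Polynomials over an algebraically closed field and their root multisets\<close>

lemma lead_coeff_prod_mset_linear:
  "lead_coeff (\<Prod>x\<in>#A. [:- x, 1:] :: 'a :: idom poly) = 1"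
  by (induction A) (simp_all add: lead_coeff_mult del: mult_pCons_left)

lemma prod_mset_linear_neq_0: "(\<Prod>x\<in>#A. [:- x, 1:] :: 'a :: idom poly) \<noteq> 0"
  using lead_coeff_prod_mset_linear[of A] by auto

lemma degree_prod_mset_linear:
  "degree (\<Prod>x\<in>#A. [:- x, 1:] :: 'a :: idom poly) = size A"
  by (induction A) (simp_all add: degree_mult_eq prod_mset_linear_neq_0 del: mult_pCons_left prod_mset_zero_iff)

lemma alg_closed_splits:
  fixes p :: "'a :: alg_closed_field poly"
  assumes "p \<noteq> 0"
  shows "p = smult (lead_coeff p) (\<Prod>x\<in>#proots p. [:-x, 1:])"
proof -
  obtain A where A: "size A = degree p" "p = smult (lead_coeff p) (\<Prod>x\<in>#A. [:-x, 1:])"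
    using alg_closed_imp_factorization[OF assms] by blast
  have "proots (\<Prod>x\<in>#A. [:-x, 1:]) = A"
  proof (induction A)
    case (add x A)
    have "proots ([:-x, 1:] * (\<Prod>x\<in>#A. [:-x, 1:])) = add_mset x A"
      by (subst proots_mult)
        (use add in \<open>simp_all add: prod_mset_linear_neq_0 del: mult_pCons_left prod_mset_zero_iff\<close>)
    thus ?case by simp
  qed simp
  hence "proots p = A"
    using A(2) assms by (metis leading_coeff_0_iff proots_smult)
  thus ?thesis using A(2) by simp
qed

lemma size_proots_alg_closed:
  fixes p :: "'a :: alg_closed_field poly"
  shows "size (proots p) = degree p"
proof (cases "p = 0")
  case False
  have "degree p = degree (smult (lead_coeff p) (\<Prod>x\<in>#proots p. [:-x, 1:]))"
    using alg_closed_splits[OF False] by metis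
  thus ?thesis using False by (simp add: degree_prod_mset_linear)
qed auto

lemma poly_alg_closed_splits:
  fixes p :: "'a :: alg_closed_field poly"
  shows "poly p y = lead_coeff p * (\<Prod>x\<in>#proots p. y - x)"
proof (cases "p = 0")
  case False
  have "poly p y = poly (smult (lead_coeff p) (\<Prod>x\<in>#proots p. [:-x, 1:])) y"
    using alg_closed_splits[OF False] by metis
  thus ?thesis by (simp add: poly_prod_mset image_mset.compositionality o_def)
qed auto

lemma poly_pderiv_at_root:
  fixes p :: "'a :: alg_closed_field poly"
  assumes "p \<noteq> 0" "proots p = add_mset u R"
  shows "poly (pderiv p) u = lead_coeff p * (\<Prod>x\<in>#R. u - x)"
proof -
  have "p = smult (lead_coeff p) ([:-u, 1:] * (\<Prod>x\<in>#R. [:-x, 1:]))"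
    using alg_closed_splits[OF assms(1)] assms(2) by simp
  then obtain c where c: "c = lead_coeff p" "p = smult c ([:-u, 1:] * (\<Prod>x\<in>#R. [:-x, 1:]))"
    by blast
  have "poly (pderiv p) u = c * (\<Prod>x\<in>#R. u - x)"
    unfolding c(2) by (simp add: pderiv_smult pderiv_mult pderiv_pCons poly_prod_mset
        image_mset.compositionality o_def del: mult_pCons_left)
  thus ?thesis using c(1) by simp
qed

text \<open>Each element of \<open>M\<close> lies in at most one member of the disjoint family, so
  it adds the same 0 or 1 to both sides.\<close>

lemma sum_size_filter_disjoint:
  assumes "finite \<U>" "pairwise disjnt \<U>"
  shows "(\<Sum>V\<in>\<U>. size {#x \<in># M. x \<in> V#}) = size {#x \<in># M. x \<in> \<Union>\<U>#}"
proof (induction M)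
  case (add y M)
  have split: "size {#x \<in># add_mset y M. x \<in> V#} = size {#x \<in># M. x \<in> V#} + (if y \<in> V then 1 else 0)" for V
    by simp
  have "(\<Sum>V\<in>\<U>. if y \<in> V then 1 else 0) = (if y \<in> \<Union>\<U> then 1 else (0::nat))"
  proof (cases "y \<in> \<Union>\<U>")
    case True
    then obtain W where W: "W \<in> \<U>" "y \<in> W" by blast
    have "(\<Sum>V\<in>\<U>. if y \<in> V then 1 else 0) = (\<Sum>V\<in>\<U>. if V = W then 1 else (0::nat))"
      using W assms(2) by (intro sum.cong refl) (auto simp: pairwise_def disjnt_iff)
    thus ?thesis using W True assms(1) by simp
  qed auto
  thus ?case using add unfolding split sum.distrib by simp
qed simp

lemma pderiv_minus_const: "pderiv ((p :: 'a :: idom poly) - [:c:]) = pderiv p"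
  by (simp add: pderiv_diff pderiv_pCons)

section \<open>Ultrametric absolute values of residue characteristic 0\<close>

locale residue_char_0_abs =
  fixes nrm :: "'a :: alg_closed_field \<Rightarrow> real"
  assumes nrm_nonneg [simp]: "nrm x \<ge> 0"
    and nrm_eq_0_iff [simp]: "nrm x = 0 \<longleftrightarrow> x = 0"
    and nrm_mult: "nrm (x * y) = nrm x * nrm y"
    and nrm_ultrametric: "nrm (x + y) \<le> max (nrm x) (nrm y)"
    and nrm_of_nat: "k > 0 \<Longrightarrow> nrm (of_nat k) = 1"
begin

lemma nrm_0 [simp]: "nrm 0 = 0" by simp

lemma nrm_1 [simp]: "nrm 1 = 1" using nrm_of_nat[of 1] by simp

lemma nrm_pos [simp]: "nrm x > 0 \<longleftrightarrow> x \<noteq> 0"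
  using nrm_nonneg[of x] nrm_eq_0_iff[of x] by linarith

lemma nrm_minus [simp]: "nrm (- x) = nrm x"
proof -
  have "nrm (-1) * nrm (-1) = 1" using nrm_mult[of "-1" "-1"] by simp
  hence "nrm (-1) = 1"
    using nrm_nonneg[of "-1"] by (metis abs_of_nonneg abs_square_eq_1 power2_eq_square)
  thus ?thesis using nrm_mult[of "-1" x] by simp
qed

lemma nrm_diff_commute: "nrm (x - y) = nrm (y - x)"
  using nrm_minus[of "x - y"] by simp

lemma nrm_diff_ultrametric: "nrm (x - z) \<le> max (nrm (x - y)) (nrm (y - z))"
  using nrm_ultrametric[of "x - y" "y - z"] by simp

lemma nrm_diff_less: "nrm (x - y) < r \<Longrightarrow> nrm (y - z) < r \<Longrightarrow> nrm (x - z) < r"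
  using nrm_diff_ultrametric[of x z y] by linarith

lemma nrm_diff_eq: "nrm (x - y) < nrm (y - z) \<Longrightarrow> nrm (x - z) = nrm (y - z)"
  using nrm_diff_ultrametric[of x z y] nrm_diff_ultrametric[of y z x] nrm_diff_commute[of x y]
  by linarith

lemma nrm_add_eq: "nrm x < nrm y \<Longrightarrow> nrm (x + y) = nrm y"
  using nrm_diff_eq[of x 0 "-y"] by simp

lemma nrm_power: "nrm (x ^ n) = nrm x ^ n"
  by (induction n) (simp_all add: nrm_mult)

lemma nrm_prod_mset: "nrm (\<Prod>x\<in>#A. g x) = (\<Prod>x\<in>#A. nrm (g x))"
  by (induction A) (simp_all add: nrm_mult)

lemma prod_mset_nrm_mono:
  "(\<And>x. x \<in># A \<Longrightarrow> nrm (g x) \<le> nrm (h x)) \<Longrightarrow> (\<Prod>x\<in>#A. nrm (g x)) \<le> (\<Prod>x\<in>#A. nrm (h x))"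
proof (induction A)
  case (add y A)
  have "0 \<le> (\<Prod>x\<in>#A. nrm (g x))" by (induction A) auto
  thus ?case using add by (auto intro!: mult_mono)
qed simp

section \<open>Newton polygons and root counting in open balls\<close>

text \<open>The number of roots in an open ball is read off the Newton polygon: it is the least index at
  which the terms of the expansion at the centre have maximal norm.\<close>

definition dominant_index :: "real \<Rightarrow> 'a poly \<Rightarrow> nat \<Rightarrow> bool" where
  "dominant_index \<rho> q n \<longleftrightarrow> coeff q n \<noteq> 0 \<and>
     (\<forall>k. nrm (coeff q k) * \<rho> ^ k \<le> nrm (coeff q n) * \<rho> ^ n) \<and>
     (\<forall>k<n. nrm (coeff q k) * \<rho> ^ k < nrm (coeff q n) * \<rho> ^ n)"

lemma dominant_index_unique: "dominant_index \<rho> q n \<Longrightarrow> dominant_index \<rho> q m \<Longrightarrow> n = m"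
  unfolding dominant_index_def by (meson linorder_neqE_nat not_less)

text \<open>A new coefficient is - b times an old one plus the old one below it; weighted by powers
  of \<open>\<rho>\<close>, these are at most |b| M and \<open>\<rho>\<close> M, with M the old
  maximum, and the larger bound decides. In a tie |b| = \<open>\<rho>\<close> the index stays n,
  because up to n the shifted terms are strictly below \<open>\<rho>\<close> M.\<close>

lemma dominant_index_mult_linear:
  assumes q: "dominant_index \<rho> q n" and \<rho>: "\<rho> > 0"
  shows "dominant_index \<rho> ([:-b, 1:] * q) (if nrm b < \<rho> then Suc n else n)"
proof -
  define M where "M = nrm (coeff q n) * \<rho> ^ n"
  define p where "p = [:-b, 1:] * q"
  have M: "M > 0" using q \<rho> by (simp add: M_def dominant_index_def)
  have le: "nrm (coeff q k) * \<rho> ^ k \<le> M" for k using q by (simp add: M_def dominant_index_def)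
  have less: "nrm (coeff q k) * \<rho> ^ k < M" if "k < n" for k
    using q that by (simp add: M_def dominant_index_def)
  define s where "s k = (if k = 0 then 0 else coeff q (k - 1))" for k
  have cp: "coeff p k = - b * coeff q k + s k" for k
    by (cases k) (simp_all add: p_def s_def coeff_pCons)
  have s_le: "nrm (s k) * \<rho> ^ k \<le> \<rho> * M" for k
    using le[of "k - 1"] \<rho> M by (cases k) (auto simp: s_def)
  have s_less: "nrm (s k) * \<rho> ^ k < \<rho> * M" if "k \<le> n" for k
    using less[of "k - 1"] \<rho> M that by (cases k) (auto simp: s_def)
  have b_le: "nrm (- b * coeff q k) * \<rho> ^ k \<le> nrm b * M" for k
    using mult_left_mono[OF le[of k], of "nrm b"] by (simp add: nrm_mult mult_ac)
  have up: "nrm (coeff p k) * \<rho> ^ k \<le> max (nrm (- b * coeff q k) * \<rho> ^ k) (nrm (s k) * \<rho> ^ k)" for k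
  proof -
    have "nrm (coeff p k) * \<rho> ^ k \<le> max (nrm (- b * coeff q k)) (nrm (s k)) * \<rho> ^ k"
      unfolding cp using nrm_ultrametric[of "- b * coeff q k" "s k"] \<rho> by (intro mult_right_mono) auto
    thus ?thesis by (auto simp: max_def split: if_splits)
  qed
  show ?thesis
  proof (cases "nrm b < \<rho>")
    case True
    have bM: "nrm b * M < \<rho> * M" using True M by simp
    have sn: "nrm (s (Suc n)) * \<rho> ^ Suc n = \<rho> * M" by (simp add: s_def M_def)
    have "nrm (- b * coeff q (Suc n)) * \<rho> ^ Suc n < nrm (s (Suc n)) * \<rho> ^ Suc n"
      using b_le[of "Suc n"] bM sn by linarith
    hence "nrm (- b * coeff q (Suc n)) < nrm (s (Suc n))"
      by (rule mult_right_less_imp_less) (use \<rho> in simp)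
    hence eq: "nrm (coeff p (Suc n)) = nrm (s (Suc n))"
      unfolding cp by (rule nrm_add_eq)
    have nz: "coeff p (Suc n) \<noteq> 0"
      using eq sn M \<rho> by (metis mult_eq_0_iff nrm_0 less_irrefl)
    show ?thesis unfolding dominant_index_def p_def[symmetric] using True nz
      apply (auto simp only: if_True eq sn)
      subgoal for k using up[of k] b_le[of k] s_le[of k] bM by linarith
      subgoal for k using up[of k] b_le[of k] s_less[of k] bM by linarith
      done
  next
    case False
    have bM: "\<rho> * M \<le> nrm b * M" using False M by simp
    have bn: "nrm (- b * coeff q n) * \<rho> ^ n = nrm b * M" by (simp add: M_def nrm_mult)
    have "nrm (s n) * \<rho> ^ n < nrm (- b * coeff q n) * \<rho> ^ n"
      using s_less[of n] bM bn by linarith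
    hence "nrm (s n) < nrm (- b * coeff q n)"
      by (rule mult_right_less_imp_less) (use \<rho> in simp)
    hence eq: "nrm (coeff p n) = nrm (- b * coeff q n)"
      unfolding cp by (metis nrm_add_eq add.commute)
    have bpos: "nrm b > 0" using False \<rho> by linarith
    have nz: "coeff p n \<noteq> 0"
      using eq bn M bpos by (metis mult_eq_0_iff nrm_0 less_irrefl)
    have b_less: "nrm (- b * coeff q k) * \<rho> ^ k < nrm b * M" if "k < n" for k
      using mult_strict_left_mono[OF less[OF that] bpos] by (simp add: nrm_mult mult_ac)
    show ?thesis unfolding dominant_index_def p_def[symmetric] using False nz
      apply (auto simp only: if_False eq bn)
      subgoal for k using up[of k] b_le[of k] s_le[of k] bM by linarith
      subgoal for k using up[of k] b_less[of k] s_less[of k] bM by linarith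
      done
  qed
qed

definition roots_in_ball :: "'a poly \<Rightarrow> 'a \<Rightarrow> real \<Rightarrow> nat" where
  "roots_in_ball p a \<rho> = size {#x \<in># proots p. nrm (x - a) < \<rho>#}"

text \<open>Move \<open>a\<close> to the origin and induct on the roots: a nonzero constant has
  dominant index 0, and a root y contributes the factor with root y - a.\<close>

lemma dominant_index_roots_in_ball:
  assumes "p \<noteq> 0" "\<rho> > 0"
  shows "dominant_index \<rho> (pcompose p [:a, 1:]) (roots_in_ball p a \<rho>)"
proof -
  have "dominant_index \<rho> (pcompose (smult c (\<Prod>x\<in>#A. [:-x, 1:])) [:a, 1:])
          (size {#x \<in># A. nrm (x - a) < \<rho>#})" if "c \<noteq> 0" for c A
  proof (induction A)
    case empty
    show ?case using that by (auto simp: dominant_index_def pcompose_smult coeff_pCons split: nat.split)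
  next
    case (add y A)
    let ?q = "pcompose (smult c (\<Prod>x\<in>#A. [:-x, 1:])) [:a, 1:]"
    have "pcompose [:-y, 1:] [:a, 1:] = [:-(y - a), 1:]"
      by (simp add: pcompose_pCons)
    hence "pcompose (smult c (\<Prod>x\<in>#add_mset y A. [:-x, 1:])) [:a, 1:] = [:-(y - a), 1:] * ?q"
      by (simp only: image_mset_add_mset prod_mset.add_mset pcompose_mult pcompose_smult mult_smult_right)
    thus ?case using dominant_index_mult_linear[OF add assms(2), of "y - a"] by (auto split: if_splits)
  qed
  from this[of "lead_coeff p" "proots p"] show ?thesis
    using assms(1) alg_closed_splits[OF assms(1)] unfolding roots_in_ball_def by simp
qed

text \<open>The integers k + 1 have norm 1, so coefficient k of the derivative has the norm of
  coefficient k + 1 of the polynomial, and the dominant index drops by one.\<close>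

lemma roots_in_ball_pderiv:
  assumes n: "roots_in_ball p a \<rho> > 0" and \<rho>: "\<rho> > 0"
  shows "roots_in_ball (pderiv p) a \<rho> = roots_in_ball p a \<rho> - 1" "pderiv p \<noteq> 0"
proof -
  obtain m where m: "roots_in_ball p a \<rho> = Suc m" using n by (cases "roots_in_ball p a \<rho>") auto
  \<comment> \<open>\<open>proots 0\<close> is empty, so a positive count excludes the zero
    polynomial.\<close>
  have p0: "p \<noteq> 0" using n by (auto simp: roots_in_ball_def)
  let ?q = "pcompose p [:a, 1:]"
  have q: "dominant_index \<rho> ?q (Suc m)"
    using dominant_index_roots_in_ball[OF p0 \<rho>, of a] m by simp
  have dq: "pcompose (pderiv p) [:a, 1:] = pderiv ?q"
    by (simp add: pderiv_pcompose pderiv_pCons)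
  have nrm_c: "nrm (coeff (pderiv ?q) k) = nrm (coeff ?q (Suc k))" for k
    by (simp add: coeff_pderiv nrm_mult nrm_of_nat del: of_nat_Suc)
  have c_nz: "coeff (pderiv ?q) m \<noteq> 0"
    using q nrm_c[of m] unfolding dominant_index_def by (metis nrm_eq_0_iff)
  have "dominant_index \<rho> (pderiv ?q) m"
    unfolding dominant_index_def
  proof (intro conjI allI impI c_nz)
    fix k
    have "\<rho> * (nrm (coeff ?q (Suc k)) * \<rho> ^ k) \<le> \<rho> * (nrm (coeff ?q (Suc m)) * \<rho> ^ m)"
      using q unfolding dominant_index_def by (metis mult.left_commute power_Suc)
    thus "nrm (coeff (pderiv ?q) k) * \<rho> ^ k \<le> nrm (coeff (pderiv ?q) m) * \<rho> ^ m"
      using \<rho> by (simp add: nrm_c)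
  next
    fix k assume "k < m"
    hence "\<rho> * (nrm (coeff ?q (Suc k)) * \<rho> ^ k) < \<rho> * (nrm (coeff ?q (Suc m)) * \<rho> ^ m)"
      using q unfolding dominant_index_def by (metis Suc_less_eq mult.left_commute power_Suc)
    thus "nrm (coeff (pderiv ?q) k) * \<rho> ^ k < nrm (coeff (pderiv ?q) m) * \<rho> ^ m"
      using \<rho> by (simp add: nrm_c)
  qed
  moreover show nz: "pderiv p \<noteq> 0" using c_nz dq[symmetric] by auto
  ultimately show "roots_in_ball (pderiv p) a \<rho> = roots_in_ball p a \<rho> - 1"
    using dominant_index_unique dominant_index_roots_in_ball[OF nz \<rho>, of a] dq m by fastforce
qed

lemma roots_in_ball_eq_0_iff:
  assumes "p \<noteq> 0"
  shows "roots_in_ball p a \<rho> = 0 \<longleftrightarrow> (\<forall>x. nrm (x - a) < \<rho> \<longrightarrow> poly p x \<noteq> 0)"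
  using assms by (auto simp: roots_in_ball_def filter_mset_eq_mempty_iff)

text \<open>Without a root in the ball the dominant index is 0, so the linear term |h'(u)| R is at
  most the constant term |h(u)|. This replaces Newton iteration: the root comes from algebraic
  closedness, not from a limit.\<close>

lemma root_near:
  assumes "nrm (poly h u) < R * nrm (poly (pderiv h) u)" "R > 0"
  obtains w where "poly h w = 0" "nrm (w - u) < R"
proof (rule ccontr)
  assume contra: "\<not> thesis"
  have h0: "h \<noteq> 0" using assms by auto
  have "roots_in_ball h u R = 0"
    using contra that by (auto simp: roots_in_ball_eq_0_iff[OF h0])
  hence "dominant_index R (pcompose h [:u, 1:]) 0"
    using dominant_index_roots_in_ball[OF h0 assms(2), of u] by simp
  hence "nrm (coeff (pcompose h [:u, 1:]) 1) * R \<le> nrm (coeff (pcompose h [:u, 1:]) 0)"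
    unfolding dominant_index_def by (metis mult.right_neutral power_0 power_one_right)
  moreover have "coeff (pcompose h [:u, 1:]) 0 = poly h u"
    by (simp add: coeff_pcompose_0)
  moreover have "coeff (pcompose h [:u, 1:]) 1 = poly (pderiv h) u"
  proof -
    have "coeff (pcompose h [:u, 1:]) 1 = coeff (pderiv (pcompose h [:u, 1:])) 0"
      by (simp add: coeff_pderiv)
    also have "\<dots> = poly (pderiv h) u"
      by (simp add: pderiv_pcompose pderiv_pCons coeff_pcompose_0)
    finally show ?thesis .
  qed
  ultimately show False using assms by (simp add: mult.commute)
qed

text \<open>A root outside the ball is equally far from all points of the ball, so every factor
  keeps its norm.\<close>

lemma nrm_poly_const_on_ball:
  assumes "\<And>x. nrm (x - a) < \<rho> \<Longrightarrow> poly p x \<noteq> 0" "nrm (x - a) < \<rho>"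
  shows "nrm (poly p x) = nrm (poly p a)"
proof -
  have "p \<noteq> 0" using assms by auto
  have "nrm (x - y) = nrm (a - y)" if "y \<in># proots p" for y
  proof -
    have "poly p y = 0" using that \<open>p \<noteq> 0\<close> by simp
    hence "\<not> nrm (y - a) < \<rho>" using assms(1) by blast
    thus ?thesis using assms(2) nrm_diff_commute[of a y] by (intro nrm_diff_eq) simp
  qed
  hence "(\<Prod>y\<in>#proots p. nrm (x - y)) = (\<Prod>y\<in>#proots p. nrm (a - y))"
    by (intro arg_cong[where f = prod_mset] image_mset_cong)
  thus ?thesis by (simp add: poly_alg_closed_splits[of p] nrm_mult nrm_prod_mset)
qed

lemma one_root_in_ball:
  assumes "roots_in_ball p a \<rho> = 1" "poly p y = 0" "nrm (y - a) < \<rho>"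
  obtains R where "p \<noteq> 0" "proots p = add_mset y R" "\<And>x. x \<in># R \<Longrightarrow> \<rho> \<le> nrm (x - a)"
proof -
  have p: "p \<noteq> 0" using assms(1) by (auto simp: roots_in_ball_def)
  then obtain R where R: "proots p = add_mset y R"
    using assms(2) multi_member_split[of y "proots p"] by auto
  have "{#x \<in># R. nrm (x - a) < \<rho>#} = {#}"
    using assms(1,3) R by (simp add: roots_in_ball_def)
  hence "\<rho> \<le> nrm (x - a)" if "x \<in># R" for x
    using that by (auto simp: filter_mset_eq_mempty_iff not_less)
  thus ?thesis using that p R by blast
qed

text \<open>Subtracting the value at y keeps the derivative, so by counting y is the only root of g
  in the ball. The other roots are equally far from x and y, whence |g(x)| = |g'(y)| |x - y|, and
  |p'| is constant on the ball.\<close>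

lemma nrm_poly_diff_on_ball:
  assumes nocrit: "\<And>c. nrm (c - a) < \<rho> \<Longrightarrow> poly (pderiv p) c \<noteq> 0"
    and x: "nrm (x - a) < \<rho>" and y: "nrm (y - a) < \<rho>"
  shows "nrm (poly p x - poly p y) = nrm (poly (pderiv p) a) * nrm (x - y)"
proof -
  define g where "g = p - [:poly p y:]"
  have dg: "pderiv g = pderiv p" by (simp add: g_def pderiv_minus_const)
  have dnz: "pderiv p \<noteq> 0" using nocrit[OF y] by auto
  hence g0: "g \<noteq> 0" using dg by auto
  have \<rho>: "\<rho> > 0" using y nrm_nonneg[of "y - a"] by linarith
  have gy: "poly g y = 0" by (simp add: g_def)
  have pos: "roots_in_ball g a \<rho> > 0"
    using roots_in_ball_eq_0_iff[OF g0, of a \<rho>] y gy by blast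
  have "roots_in_ball (pderiv p) a \<rho> = 0"
    using roots_in_ball_eq_0_iff[OF dnz] nocrit by blast
  hence "roots_in_ball g a \<rho> = 1"
    using roots_in_ball_pderiv(1)[OF pos \<rho>] pos dg by simp
  then obtain R where R: "proots g = add_mset y R" "\<And>x. x \<in># R \<Longrightarrow> \<rho> \<le> nrm (x - a)"
    using one_root_in_ball[OF _ gy y] by metis
  have "nrm (x - s) = nrm (y - s)" if "s \<in># R" for s
  proof -
    have "nrm (x - y) < \<rho>" using nrm_diff_less[OF x, of y] y nrm_diff_commute[of a y] by simp
    moreover have "\<not> nrm (y - s) < \<rho>"
      using R(2)[OF that] nrm_diff_less[of s y \<rho> a] y nrm_diff_commute[of s y] by linarith
    ultimately show ?thesis by (intro nrm_diff_eq) linarith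
  qed
  hence eq: "(\<Prod>s\<in>#R. nrm (x - s)) = (\<Prod>s\<in>#R. nrm (y - s))"
    by (intro arg_cong[where f = prod_mset] image_mset_cong)
  have "nrm (poly g x) = nrm (lead_coeff g) * (nrm (x - y) * (\<Prod>s\<in>#R. nrm (x - s)))"
    by (simp add: poly_alg_closed_splits[of g] R(1) nrm_mult nrm_prod_mset)
  also have "\<dots> = nrm (poly (pderiv g) y) * nrm (x - y)"
    by (simp add: eq poly_pderiv_at_root[OF g0 R(1)] nrm_mult nrm_prod_mset mult_ac)
  also have "nrm (poly (pderiv g) y) = nrm (poly (pderiv p) a)"
    unfolding dg using nrm_poly_const_on_ball[OF nocrit y] by blast
  finally show ?thesis by (simp add: g_def)
qed

section \<open>Existence of expanding branches\<close>

lemma power_size_le_prod_mset: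
  fixes g :: "'b \<Rightarrow> real"
  assumes "r \<ge> 0" "\<And>y. y \<in># M \<Longrightarrow> r \<le> g y"
  shows "r ^ size M \<le> (\<Prod>y\<in>#M. g y)"
  using assms(2)
proof (induction M)
  case (add y M)
  thus ?case using assms(1) by (auto intro!: mult_mono intro: order_trans)
qed simp

text \<open>Without critical points f multiplies distances in the ball about u by |f'(u)|, so the
  last inequality says that this ball is mapped injectively onto a ball about \<open>\<zeta>\<close>
  of radius at least r.\<close>

definition expanding_branch :: "'a poly \<Rightarrow> real \<Rightarrow> 'a \<Rightarrow> 'a \<Rightarrow> 'a \<Rightarrow> real \<Rightarrow> bool" where
  "expanding_branch f r z \<zeta> u \<rho> \<longleftrightarrow> poly f u = \<zeta> \<and> nrm (u - z) < r \<and> 0 < \<rho> \<and> \<rho> < r \<and>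
     (\<forall>c. nrm (c - u) < \<rho> \<longrightarrow> poly (pderiv f) c \<noteq> 0) \<and> r \<le> \<rho> * nrm (poly (pderiv f) u)"

text \<open>Otherwise every root y of f - z2 satisfies |z1 - y| >= r, and the factorisation makes
  |f(z1) - z2| exceed r; but f(z1) - z2 = z1 - z2 has norm r.\<close>

lemma root_in_ball_of_level:
  assumes deg: "degree f > 0" and r: "r = nrm (z1 - z2)" "z1 \<noteq> z2" and fp: "poly f z1 = z1"
    and large: "nrm (lead_coeff f) * r ^ degree f > r"
  obtains y where "poly f y = z2" "nrm (y - z1) < r"
proof (rule ccontr)
  assume contra: "\<not> thesis"
  define g where "g = f + [:- z2:]"
  have g: "degree g = degree f" "lead_coeff g = lead_coeff f"
    using deg by (simp_all add: g_def degree_add_eq_left coeff_pCons split: nat.split)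
  have g0: "g \<noteq> 0" using deg g by auto
  have "r \<le> nrm (z1 - y)" if "y \<in># proots g" for y
    using that g0 contra \<open>\<And>y. poly f y = z2 \<Longrightarrow> nrm (y - z1) < r \<Longrightarrow> thesis\<close> nrm_diff_commute[of y z1]
    by (force simp: g_def not_less)
  hence "r ^ degree f \<le> (\<Prod>y\<in>#proots g. nrm (z1 - y))"
    using power_size_le_prod_mset[of r "proots g"] r by (simp add: size_proots_alg_closed g)
  hence "nrm (lead_coeff f) * r ^ degree f \<le> nrm (poly g z1)"
    unfolding poly_alg_closed_splits[of g] g(2) nrm_mult nrm_prod_mset by (intro mult_left_mono) auto
  also have "\<dots> = r" by (simp add: g_def fp r)
  finally show False using large by simp
qed

lemma expanding_branch_exists:
  assumes deg: "degree f > 0" and r: "r = nrm (z1 - z2)" "z1 \<noteq> z2" and fp: "poly f z1 = z1"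
    and large: "nrm (lead_coeff f) * r ^ degree f > r"
  obtains \<zeta> u \<rho> where "\<zeta> \<in> {z1, z2}" "expanding_branch f r z1 \<zeta> u \<rho>"
proof -
  define g1 where "g1 = f - [:z1:]"
  define g2 where "g2 = f - [:z2:]"
  have gnz: "f - [:z:] \<noteq> 0" for z using deg by auto
  have dg: "pderiv g1 = pderiv f" "pderiv g2 = pderiv f" by (simp_all add: g1_def g2_def pderiv_minus_const)
  have nz: "g1 \<noteq> 0" "g2 \<noteq> 0" using gnz by (auto simp: g1_def g2_def)
  have rpos: "r > 0" using r by simp
  define B where "B = (\<lambda>x. nrm (x - z1) < r)"
  define A1 where "A1 = {#x \<in># proots g1. B x#}"
  define A2 where "A2 = {#x \<in># proots g2. B x#}"
  define C where "C = {#x \<in># proots (pderiv f). B x#}"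
  have z1A: "z1 \<in># A1" using nz fp rpos by (auto simp: A1_def g1_def B_def)
  obtain y where y: "poly f y = z2" "nrm (y - z1) < r"
    using root_in_ball_of_level[OF assms] by blast
  hence yA: "y \<in># A2" using nz by (auto simp: A2_def g2_def B_def)
  have sz: "size A1 = roots_in_ball g1 z1 r" "size A2 = roots_in_ball g2 z1 r"
           "size C = roots_in_ball (pderiv f) z1 r"
    by (simp_all add: A1_def A2_def C_def roots_in_ball_def B_def)
  have pos: "size A1 > 0" "size A2 > 0" using z1A yA by (auto intro!: Nat.gr0I)
  \<comment> \<open>\<open>g1\<close> and \<open>g2\<close> have the same derivative, so both fibres
    exceed the critical points in \<open>B\<close> by exactly one, with multiplicity.\<close>
  have cnt: "size A1 = Suc (size C)" "size A2 = Suc (size C)"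
    using roots_in_ball_pderiv(1)[of g1 z1 r] roots_in_ball_pderiv(1)[of g2 z1 r] pos rpos
    unfolding sz dg by simp_all
  have dnz: "pderiv f \<noteq> 0" using roots_in_ball_pderiv(2)[of g1 z1 r] pos(1) rpos sz dg by simp
  define S1 where "S1 = set_mset A1"
  define S2 where "S2 = set_mset A2"
  have S1: "x \<in> S1 \<longleftrightarrow> poly f x = z1 \<and> B x" and S2: "x \<in> S2 \<longleftrightarrow> poly f x = z2 \<and> B x" for x
    using nz by (auto simp: S1_def S2_def A1_def A2_def g1_def g2_def)
  have disj: "S1 \<inter> S2 = {}" using S1 S2 r(2) by auto
  have fin: "finite S1" "finite S2" by (simp_all add: S1_def S2_def)
  have ne: "S1 \<noteq> {}" "S2 \<noteq> {}" using z1A yA by (auto simp: S1_def S2_def)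
  define S where "S = S1 \<union> S2"
  \<comment> \<open>\<open>opp u\<close> is the fibre not containing u and \<open>\<rho> u\<close>
    the distance to it, so \<open>U u\<close> is the largest open ball about u that misses it;
    \<open>G u\<close> vanishes on the fibre of u.\<close>
  define opp where "opp u = (if u \<in> S1 then S2 else S1)" for u
  define G where "G u = (if u \<in> S1 then g1 else g2)" for u
  define \<rho> where "\<rho> u = Min ((\<lambda>x. nrm (u - x)) ` opp u)" for u
  define U where "U u = {x. nrm (x - u) < \<rho> u}" for u
  have opp: "finite (opp u)" "opp u \<noteq> {}" "opp u \<subseteq> S" for u using fin ne by (auto simp: opp_def S_def)
  have \<rho>_le: "\<rho> u \<le> nrm (u - x)" if "x \<in> opp u" for u x
    using that opp unfolding \<rho>_def by (intro Min_le) auto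
  have \<rho>_ex: "\<exists>x\<in>opp u. \<rho> u = nrm (u - x)" for u
  proof -
    have "\<rho> u \<in> (\<lambda>x. nrm (u - x)) ` opp u" unfolding \<rho>_def using opp by (intro Min_in) auto
    thus ?thesis by blast
  qed
  have SB: "B x" if "x \<in> S" for x using that S1 S2 by (auto simp: S_def)
  have \<rho>_pos: "\<rho> u > 0" if "u \<in> S" for u
  proof -
    obtain x where "x \<in> opp u" "\<rho> u = nrm (u - x)" using \<rho>_ex by blast
    thus ?thesis using that disj by (auto simp: opp_def S_def split: if_splits)
  qed
  have \<rho>_less: "\<rho> u < r" if "u \<in> S" for u
  proof -
    obtain x where x: "x \<in> opp u" "\<rho> u = nrm (u - x)" using \<rho>_ex by blast
    hence "B x" "B u" using opp(3)[of u] SB that by blast+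
    thus ?thesis using nrm_diff_less[of u z1 r x] x nrm_diff_commute[of x z1] by (simp add: B_def)
  qed
  have UB: "B x" if "u \<in> S" "x \<in> U u" for u x
    using nrm_diff_less[of x u r z1] \<rho>_less[OF that(1)] SB[OF that(1)] that(2) by (simp add: B_def U_def)
  \<comment> \<open>Such a v is too close to u to lie in the opposite fibre, and by the isosceles
    property has the same distances to that fibre as u, hence the same radius.\<close>
  have same: "(u \<in> S1 \<longleftrightarrow> v \<in> S1) \<and> U u = U v" if uv: "u \<in> S" "v \<in> S" "nrm (u - v) < \<rho> u" for u v
  proof -
    have "v \<notin> opp u" using \<rho>_le[of v u] uv by auto
    hence eq: "u \<in> S1 \<longleftrightarrow> v \<in> S1" using uv disj by (auto simp: opp_def S_def split: if_splits)
    hence opp_eq: "opp u = opp v" by (simp add: opp_def)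
    have "nrm (v - x) = nrm (u - x)" if "x \<in> opp u" for x
      using \<rho>_le[OF that] uv(3) nrm_diff_eq[of v u x] nrm_diff_commute[of u v] by simp
    hence "\<rho> u = \<rho> v" unfolding \<rho>_def opp_eq[symmetric]
      by (intro arg_cong[where f = Min] image_cong) auto
    hence "U u = U v"
      using uv(3) nrm_diff_less[of _ u "\<rho> u" v] nrm_diff_less[of _ v "\<rho> u" u] nrm_diff_commute[of u v]
      by (auto simp: U_def)
    thus ?thesis using eq by blast
  qed
  have dj: "pairwise disjnt (U ` S)"
  proof (rule pairwiseI)
    fix V W assume "V \<in> U ` S" "W \<in> U ` S" "V \<noteq> W"
    then obtain u v where uv: "u \<in> S" "v \<in> S" "V = U u" "W = U v" "U u \<noteq> U v" by blast
    \<comment> \<open>If two balls meet, their centres are closer than the larger radius, and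
      \<open>same\<close> at that centre makes the balls equal.\<close>
    have False if "x \<in> U u" "x \<in> U v" for x
    proof -
      have "nrm (u - v) < max (\<rho> u) (\<rho> v)"
        using that nrm_diff_ultrametric[of u v x] nrm_diff_commute[of u x] by (auto simp: U_def)
      thus False using same[of u v] same[of v u] uv nrm_diff_commute[of u v] by (auto simp: max_def split: if_splits)
    qed
    thus "disjnt V W" using uv by (auto simp: disjnt_iff)
  qed
  have finU: "finite (U ` S)" using fin by (simp add: S_def)
  have self: "u \<in> U u" if "u \<in> S" for u using \<rho>_pos[OF that] by (simp add: U_def)
  have cntU: "size {#x \<in># A1 + A2. x \<in> U u#} = roots_in_ball (G u) u (\<rho> u)" if u: "u \<in> S" for u
  proof (cases "u \<in> S1")
    case True
    have "x \<notin> U u" if "x \<in># A2" for x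
      using same[OF u, of x] that True disj nrm_diff_commute[of u x] by (auto simp: S_def S2_def U_def)
    hence "{#x \<in># A2. x \<in> U u#} = {#}" by (auto simp: filter_mset_eq_mempty_iff)
    moreover have "{#x \<in># A1. x \<in> U u#} = {#x \<in># proots g1. x \<in> U u#}"
      unfolding A1_def filter_filter_mset using UB[OF u] by (intro filter_mset_cong) auto
    ultimately show ?thesis using True by (simp add: G_def roots_in_ball_def U_def)
  next
    case False
    have "x \<notin> U u" if "x \<in># A1" for x
      using same[OF u, of x] that False disj nrm_diff_commute[of u x] by (auto simp: S_def S1_def U_def)
    hence "{#x \<in># A1. x \<in> U u#} = {#}" by (auto simp: filter_mset_eq_mempty_iff)
    moreover have "{#x \<in># A2. x \<in> U u#} = {#x \<in># proots g2. x \<in> U u#}"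
      unfolding A2_def filter_filter_mset using UB[OF u] by (intro filter_mset_cong) auto
    ultimately show ?thesis using False by (simp add: G_def roots_in_ball_def U_def)
  qed
  have cntC: "size {#x \<in># C. x \<in> U u#} = roots_in_ball (pderiv f) u (\<rho> u)" if u: "u \<in> S" for u
  proof -
    have "{#x \<in># C. x \<in> U u#} = {#x \<in># proots (pderiv f). x \<in> U u#}"
      unfolding C_def filter_filter_mset using UB[OF u] by (intro filter_mset_cong) auto
    thus ?thesis by (simp add: roots_in_ball_def U_def)
  qed
  have dG: "pderiv (G u) = pderiv f" and G0: "G u \<noteq> 0" for u using dg nz by (auto simp: G_def)
  have Gu: "poly (G u) u = 0" if "u \<in> S" for u
    using that S1 S2 by (auto simp: G_def S_def g1_def g2_def)
  have Gpos: "roots_in_ball (G u) u (\<rho> u) > 0" if "u \<in> S" for u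
    using roots_in_ball_eq_0_iff[OF G0[of u], of u "\<rho> u"] Gu[OF that] \<rho>_pos[OF that] by auto
  have Gcrit: "roots_in_ball (pderiv f) u (\<rho> u) = roots_in_ball (G u) u (\<rho> u) - 1" if "u \<in> S" for u
    using roots_in_ball_pderiv(1)[OF Gpos[OF that] \<rho>_pos[OF that]] dG by simp
  have "\<exists>u\<in>S. roots_in_ball (G u) u (\<rho> u) = 1"
  proof (rule ccontr)
    assume none: "\<not> ?thesis"
    have "size A1 + size A2 = size {#x \<in># A1 + A2. x \<in> \<Union>(U ` S)#}"
    proof -
      have "{#x \<in># A1 + A2. x \<in> \<Union>(U ` S)#} = {#x \<in># A1 + A2. True#}"
        using self by (intro filter_mset_cong refl) (auto simp: S_def S1_def S2_def)
      thus ?thesis by simp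
    qed
    \<comment> \<open>Summing over the set of balls counts a ball shared by several centres only
      once.\<close>
    also have "\<dots> = (\<Sum>V\<in>U ` S. size {#x \<in># A1 + A2. x \<in> V#})"
      by (rule sum_size_filter_disjoint[OF finU dj, symmetric])
    also have "\<dots> \<le> (\<Sum>V\<in>U ` S. 2 * size {#x \<in># C. x \<in> V#})"
    proof (rule sum_mono)
      fix V assume "V \<in> U ` S"
      then obtain u where u: "u \<in> S" "V = U u" by blast
      \<comment> \<open>A ball with n >= 2 points of its fibre has n - 1 critical points, and n <= 2
        (n - 1).\<close>
      have "roots_in_ball (G u) u (\<rho> u) \<noteq> 1" using none u by blast
      thus "size {#x \<in># A1 + A2. x \<in> V#} \<le> 2 * size {#x \<in># C. x \<in> V#}"
        unfolding u(2) cntU[OF u(1)] cntC[OF u(1)] Gcrit[OF u(1)] using Gpos[OF u(1)] by linarith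
    qed
    also have "\<dots> = 2 * size {#x \<in># C. x \<in> \<Union>(U ` S)#}"
      by (simp only: sum_distrib_left[symmetric] sum_size_filter_disjoint[OF finU dj])
    also have "\<dots> \<le> 2 * size C" by (simp add: size_filter_mset_lesseq)
    finally show False using cnt by simp
  qed
  then obtain u where u: "u \<in> S" and one: "roots_in_ball (G u) u (\<rho> u) = 1" by blast
  have nocrit: "\<forall>c. nrm (c - u) < \<rho> u \<longrightarrow> poly (pderiv f) c \<noteq> 0"
    using Gcrit[OF u] one roots_in_ball_eq_0_iff[OF dnz] by simp
  obtain R where R: "proots (G u) = add_mset u R" "\<And>x. x \<in># R \<Longrightarrow> \<rho> u \<le> nrm (x - u)"
    using one_root_in_ball[OF one Gu[OF u]] \<rho>_pos[OF u] by auto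
  \<comment> \<open>At a nearest point v of the opposite fibre \<open>G u\<close> has norm r. The
    other roots x of \<open>G u\<close> have |u - x| >= \<open>\<rho> u\<close> = |u - v|, so
    replacing v by u in the factors v - x does not decrease their norms.\<close>
  obtain v where v: "v \<in> opp u" "\<rho> u = nrm (u - v)" using \<rho>_ex by blast
  have "r = nrm (poly (G u) v)"
    using v(1) S1[of v] S2[of v] disj u r(1) nrm_diff_commute[of z1 z2]
    by (auto simp: G_def opp_def S_def g1_def g2_def split: if_splits)
  also have "\<dots> = nrm (lead_coeff (G u)) * (\<rho> u * (\<Prod>x\<in>#R. nrm (v - x)))"
    using nrm_diff_commute[of u v]
    by (simp add: poly_alg_closed_splits[of "G u"] R(1) nrm_mult nrm_prod_mset v(2))
  also have "\<dots> \<le> nrm (lead_coeff (G u)) * (\<rho> u * (\<Prod>x\<in>#R. nrm (u - x)))"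
  proof -
    have "nrm (v - x) \<le> nrm (u - x)" if "x \<in># R" for x
      using R(2)[OF that] nrm_diff_ultrametric[of v x u] v(2) nrm_diff_commute[of u v] nrm_diff_commute[of u x]
      by simp
    thus ?thesis using \<rho>_pos[OF u] by (intro mult_left_mono prod_mset_nrm_mono) auto
  qed
  also have "\<dots> = \<rho> u * nrm (poly (pderiv f) u)"
    using poly_pderiv_at_root[OF G0 R(1)] dG by (simp add: nrm_mult nrm_prod_mset mult_ac)
  finally have "r \<le> \<rho> u * nrm (poly (pderiv f) u)" .
  hence "expanding_branch f r z1 (poly f u) u (\<rho> u)"
    using nocrit \<rho>_pos[OF u] \<rho>_less[OF u] SB[OF u] by (simp add: expanding_branch_def B_def)
  moreover have "poly f u \<in> {z1, z2}" using u S1 S2 by (auto simp: S_def)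
  ultimately show ?thesis using that by blast
qed

section \<open>Repelling points from expanding branches\<close>

lemma expanding_branch_nrm_gt_1:
  assumes "expanding_branch f r z \<zeta> u \<rho>"
  shows "nrm (poly (pderiv f) u) > 1"
proof (rule ccontr)
  assume "\<not> ?thesis"
  hence "\<rho> * nrm (poly (pderiv f) u) \<le> \<rho> * 1"
    using assms by (intro mult_left_mono) (auto simp: expanding_branch_def)
  moreover have "\<rho> < r" "r \<le> \<rho> * nrm (poly (pderiv f) u)"
    using assms by (auto simp: expanding_branch_def)
  ultimately show False by linarith
qed

lemma expanding_branch_nrm_pderiv:
  assumes "expanding_branch f r z \<zeta> u \<rho>" "nrm (x - u) < \<rho>"
  shows "nrm (poly (pderiv f) x) = nrm (poly (pderiv f) u)"
  using assms by (intro nrm_poly_const_on_ball) (auto simp: expanding_branch_def)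

lemma expanding_branch_in_ball:
  assumes "expanding_branch f r z \<zeta> u \<rho>" "nrm (x - u) < \<rho>"
  shows "nrm (x - z) < r"
  using assms nrm_diff_less[of x u r z] by (auto simp: expanding_branch_def)

text \<open>Apply \<open>root_near\<close> to f - X at u: the value z - u has norm below r, and the
  derivative has norm |f'(u)| because this exceeds 1. The root stays in the ball, where |f'| is
  constant.\<close>

lemma repelling_fixed_point_of_branch:
  assumes br: "expanding_branch f r z z u \<rho>"
  obtains w where "poly f w = w" "nrm (poly (pderiv f) w) > 1"
proof -
  define h where "h = f - [:0, 1:]"
  have gt: "nrm (poly (pderiv f) u) > 1" by (rule expanding_branch_nrm_gt_1[OF br])
  have "poly (pderiv h) u = -1 + poly (pderiv f) u" by (simp add: h_def pderiv_diff pderiv_pCons)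
  hence dh: "nrm (poly (pderiv h) u) = nrm (poly (pderiv f) u)"
    using nrm_add_eq[of "-1" "poly (pderiv f) u"] gt by simp
  have "nrm (poly h u) < r" using br nrm_diff_commute[of u z] by (simp add: h_def expanding_branch_def)
  hence "nrm (poly h u) < \<rho> * nrm (poly (pderiv h) u)"
    unfolding dh using br by (auto simp: expanding_branch_def)
  then obtain w where w: "poly h w = 0" "nrm (w - u) < \<rho>"
    using root_near[of h u \<rho>] br by (auto simp: expanding_branch_def)
  show ?thesis
    by (rule that[of w]) (use w expanding_branch_nrm_pderiv[OF br w(2)] gt in \<open>simp_all add: h_def\<close>)
qed

text \<open>\<open>root_near\<close> is applied to f(f(X)) - X. The resulting w and f(w) lie in the
  disjoint balls of radius r about z1 and z2, so the period is exactly 2.\<close>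

lemma repelling_2_periodic_point_of_branches:
  assumes r: "r = nrm (z1 - z2)"
    and br1: "expanding_branch f r z1 z2 u \<rho>" and br2: "expanding_branch f r z2 z1 v \<sigma>"
  obtains w where "poly f (poly f w) = w" "poly f w \<noteq> w"
    "nrm (poly (pderiv f) (poly f w) * poly (pderiv f) w) > 1"
proof -
  define a where "a = nrm (poly (pderiv f) u)"
  define b where "b = nrm (poly (pderiv f) v)"
  have a: "a > 1" and b: "b > 1"
    using expanding_branch_nrm_gt_1[OF br1] expanding_branch_nrm_gt_1[OF br2] by (simp_all add: a_def b_def)
  have ab: "a * b > 1" using a b by (simp add: less_1_mult)
  have \<rho>: "\<rho> > 0" "r \<le> \<rho> * a" and \<sigma>: "\<sigma> > 0" "r \<le> \<sigma> * b" and fuv: "poly f u = z2" "poly f v = z1"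
    using br1 br2 by (simp_all add: expanding_branch_def a_def b_def)
  have rpos: "r > 0" using \<rho> br1 by (auto simp: expanding_branch_def)
  \<comment> \<open>First solve f(s) = v near u: along s, v, z1 the value of the second iterate and
    the norm of its derivative are known.\<close>
  define g where "g = f - [:v:]"
  have "nrm (poly g u) < \<rho> * nrm (poly (pderiv g) u)"
    using br2 \<rho>(2) nrm_diff_commute[of v z2] 
    by (simp add: g_def pderiv_minus_const fuv expanding_branch_def a_def)
  then obtain s where "poly g s = 0" and s: "nrm (s - u) < \<rho>"
    using root_near[of g u \<rho>] \<rho>(1) by blast
  hence fs: "poly f s = v" by (simp add: g_def)
  have das: "nrm (poly (pderiv f) s) = a"
    using expanding_branch_nrm_pderiv[OF br1 s] by (simp add: a_def)
  define h where "h = pcompose f f - [:0, 1:]"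
  have dh: "poly (pderiv h) x = -1 + poly (pderiv f) (poly f x) * poly (pderiv f) x" for x
    by (simp add: h_def pderiv_diff pderiv_pCons pderiv_pcompose poly_pcompose)
  have dhs: "nrm (poly (pderiv h) s) = a * b"
    unfolding dh using ab nrm_add_eq[of "-1" "poly (pderiv f) (poly f s) * poly (pderiv f) s"] das fs
    by (simp add: nrm_mult b_def mult.commute)
  have "nrm (poly h s) = nrm (z1 - s)" by (simp add: h_def poly_pcompose fs fuv)
  hence "nrm (poly h s) < r"
    using expanding_branch_in_ball[OF br1 s] nrm_diff_commute[of s z1] by simp
  \<comment> \<open>The radius r / (a b) is at most \<open>\<rho>\<close>, and f stretches it by a
    to r / b <= \<open>\<sigma>\<close>; thus w and f(w) stay in the balls of the two
    branches.\<close>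
  also have "r = r / (a * b) * nrm (poly (pderiv h) s)" using dhs a b by simp
  finally obtain w where "poly h w = 0" and ws: "nrm (w - s) < r / (a * b)"
    using root_near[of h s "r / (a * b)"] rpos ab by auto
  hence w: "poly f (poly f w) = w" by (simp add: h_def poly_pcompose)
  have aws: "a * nrm (w - s) < r / b" using ws a b by (simp add: field_simps)
  have rb: "r / b \<le> \<sigma>" using \<sigma>(2) b by (simp add: field_simps)
  have "r / (a * b) \<le> \<rho>"
  proof -
    have "r * 1 \<le> (\<rho> * a) * b" using \<rho> a b rpos by (intro mult_mono) auto
    thus ?thesis using ab a b by (simp add: field_simps)
  qed
  hence wu: "nrm (w - u) < \<rho>" using nrm_diff_less[of w s \<rho> u] ws s by simp
  have "nrm (poly f w - poly f s) = a * nrm (w - s)"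
    unfolding a_def using br1 by (intro nrm_poly_diff_on_ball[OF _ wu s]) (auto simp: expanding_branch_def)
  hence fwv: "nrm (poly f w - v) < \<sigma>" using aws rb fs by simp
  have "nrm (poly f w - z2) < r" by (rule expanding_branch_in_ball[OF br2 fwv])
  moreover have "nrm (w - z1) < r" by (rule expanding_branch_in_ball[OF br1 wu])
  ultimately have "poly f w \<noteq> w"
    using r nrm_diff_less[of z1 w r z2] nrm_diff_commute[of w z1] by auto
  moreover have "nrm (poly (pderiv f) (poly f w) * poly (pderiv f) w) > 1"
    using expanding_branch_nrm_pderiv[OF br1 wu] expanding_branch_nrm_pderiv[OF br2 fwv] ab
    by (simp add: nrm_mult a_def b_def mult.commute)
  ultimately show ?thesis using that w by blast
qed

lemma repelling_point_of_period_le_2: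
  assumes deg: "degree f > 0" and ne: "z1 \<noteq> z2" and fp: "poly f z1 = z1" "poly f z2 = z2"
    and large: "nrm (lead_coeff f) * nrm (z1 - z2) ^ (degree f - 1) > 1"
  shows "(\<exists>w. poly f w = w \<and> nrm (poly (pderiv f) w) > 1) \<or>
         (\<exists>w. poly f (poly f w) = w \<and> poly f w \<noteq> w \<and>
              nrm (poly (pderiv f) (poly f w) * poly (pderiv f) w) > 1)"
proof -
  define r where "r = nrm (z1 - z2)"
  have rpos: "r > 0" using ne by (simp add: r_def)
  have r': "r = nrm (z2 - z1)" by (simp add: r_def nrm_diff_commute)
  have "r * 1 < r * (nrm (lead_coeff f) * r ^ (degree f - 1))"
    using large rpos by (intro mult_strict_left_mono) (auto simp: r_def)
  also have "\<dots> = nrm (lead_coeff f) * r ^ degree f"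
    using deg by (cases "degree f") simp_all
  finally have large': "nrm (lead_coeff f) * r ^ degree f > r" by simp
  obtain \<zeta> u \<rho> where 1: "\<zeta> \<in> {z1, z2}" "expanding_branch f r z1 \<zeta> u \<rho>"
    using expanding_branch_exists[OF deg r_def ne fp(1) large'] by blast
  obtain \<xi> v \<sigma> where 2: "\<xi> \<in> {z2, z1}" "expanding_branch f r z2 \<xi> v \<sigma>"
    using expanding_branch_exists[OF deg r' ne[symmetric] fp(2) large'] by blast
  consider "\<zeta> = z1" | "\<xi> = z2" | "\<zeta> = z2" "\<xi> = z1" using 1 2 by auto
  thus ?thesis
    using repelling_fixed_point_of_branch[of f r z1 u \<rho>] repelling_fixed_point_of_branch[of f r z2 v \<sigma>]
      repelling_2_periodic_point_of_branches[OF r_def, of f u \<rho> v \<sigma>] 1 2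
    by cases metis+
qed

section \<open>Repelling fixed points in degrees 2 and 3\<close>

lemma repelling_fixed_point_degree_le_3:
  assumes deg: "degree f \<in> {2, 3}" and ne: "z1 \<noteq> z2" and fp: "poly f z1 = z1" "poly f z2 = z2"
    and large: "nrm (lead_coeff f) * nrm (z1 - z2) ^ (degree f - 1) > 1"
  obtains w where "poly f w = w" "nrm (poly (pderiv f) w) > 1"
proof -
  note thesisI = that
  define g where "g = f + [:0, -1:]"
  have g: "degree g = degree f" "lead_coeff g = lead_coeff f"
    using deg by (auto simp: g_def degree_add_eq_left coeff_pCons numeral_2_eq_2 numeral_3_eq_3)
  hence lc: "coeff g (degree f) = lead_coeff f" by simp
  have g0: "g \<noteq> 0" using deg g by auto
  have dg: "pderiv g = pderiv f - 1" by (simp add: g_def pderiv_add pderiv_pCons one_pCons)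
  have rep: ?thesis if "w \<in># proots g" "nrm (poly (pderiv g) w) > 1" for w
  proof (rule thesisI)
    show "poly f w = w" using that(1) g0 by (simp add: g_def)
    show "nrm (poly (pderiv f) w) > 1"
      using that(2) nrm_add_eq[of 1 "poly (pderiv g) w"] by (simp add: dg)
  qed
  obtain R where "proots g = add_mset z1 R"
    using fp g0 multi_member_split[of z1 "proots g"] by (auto simp: g_def)
  moreover from this have "z2 \<in># R"
    using fp(2) g0 ne set_count_proots[OF g0] by (auto simp: g_def)
  ultimately obtain T where T: "proots g = add_mset z1 (add_mset z2 T)"
    using multi_member_split by metis
  hence T': "proots g = add_mset z2 (add_mset z1 T)" by (simp add: add_mset_commute)
  note d1 = poly_pderiv_at_root[OF g0 T] and d2 = poly_pderiv_at_root[OF g0 T']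
  have szT: "size T = degree f - 2" using size_proots_alg_closed[of g] T g by simp
  show ?thesis
  proof (cases "degree f = 2")
    case True
    thus ?thesis using szT d1 large lc by (intro rep[of z1]) (simp_all add: T g nrm_mult)
  next
    case False
    hence d3: "degree f = 3" using deg by simp
    then obtain z3 where z3: "T = {#z3#}" using szT size_1_singleton_mset[of T] by auto
    let ?r = "nrm (z1 - z2)"
    have large3: "nrm (lead_coeff f) * (?r * ?r) > 1" using large d3 by (simp add: power2_eq_square)
    have *: "nrm (lead_coeff f) * (?r * x) > 1" if "?r \<le> x" for x
    proof -
      have "nrm (lead_coeff f) * (?r * ?r) \<le> nrm (lead_coeff f) * (?r * x)"
        using that by (intro mult_left_mono) auto
      thus ?thesis using large3 by linarith
    qed
    show ?thesis
    proof (cases "?r \<le> nrm (z1 - z3)")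
      case True
      thus ?thesis using d1 *[OF True] lc by (intro rep[of z1]) (simp_all add: T z3 g nrm_mult)
    next
      case False
      \<comment> \<open>The triangle is isosceles since z3 is nearer to z1 than z2 is; z3 = z1 is
        included.\<close>
      hence "nrm (z2 - z3) = ?r"
        using nrm_diff_eq[of z3 z1 z2] nrm_diff_commute[of z1 z3] nrm_diff_commute[of z2 z3] by simp
      hence le: "?r \<le> nrm (z2 - z3)" by simp
      show ?thesis using d2 *[OF le] lc nrm_diff_commute[of z1 z2]
        by (intro rep[of z2]) (simp_all add: T z3 g nrm_mult)
    qed
  qed
qed

section \<open>Conjugation to a monic integral polynomial\<close>

lemma nrm_coeff_prod_mset_linear_le_1:
  assumes "\<And>x. x \<in># A \<Longrightarrow> nrm (h x) \<le> 1"
  shows "nrm (coeff (\<Prod>x\<in>#A. [:- h x, 1:]) k) \<le> 1"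
  using assms
proof (induction A arbitrary: k)
  case (add y A)
  let ?P = "\<Prod>x\<in>#A. [:- h x, 1:]"
  have IH: "nrm (coeff ?P k) \<le> 1" for k using add by simp
  have "nrm (- h y * coeff ?P k) \<le> 1"
    using add.prems[of y] IH[of k] by (simp add: nrm_mult mult_le_one)
  moreover have "nrm (coeff (pCons 0 ?P) k) \<le> 1" using IH by (cases k) auto
  moreover have "coeff (\<Prod>x\<in>#add_mset y A. [:- h x, 1:]) k = - h y * coeff ?P k + coeff (pCons 0 ?P) k"
    by simp
  ultimately show ?case using nrm_ultrametric[of "- h y * coeff ?P k" "coeff (pCons 0 ?P) k"] by simp
qed (simp add: coeff_pCons split: nat.split)

text \<open>In the coordinate x + s X the fixed points y become (y - x) / s, of norm at most 1, and
  f - X becomes s times a monic H with these roots. The conjugate of f is F = X + H, still monic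
  because the degree is at least 2.\<close>

lemma integral_conjugate:
  assumes deg: "degree f \<ge> 2"
    and small: "\<And>x y. poly f x = x \<Longrightarrow> poly f y = y \<Longrightarrow>
                  nrm (lead_coeff f) * nrm (x - y) ^ (degree f - 1) \<le> 1"
  obtains s x F where "s \<noteq> 0" "pcompose f [:x, s:] - [:x:] = smult s F"
    "degree F = degree f" "lead_coeff F = 1" "\<And>k. nrm (coeff F k) \<le> 1"
proof -
  define d where "d = degree f"
  define c where "c = lead_coeff f"
  have c0: "c \<noteq> 0" using deg by (auto simp: c_def)
  define g where "g = f + [:0, -1:]"
  have g: "degree g = d" "lead_coeff g = c"
    using deg by (auto simp: g_def c_def d_def degree_add_eq_left coeff_pCons split: nat.split)
  have g0: "g \<noteq> 0" using deg g by (auto simp: d_def)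
  have szg: "size (proots g) = d" using size_proots_alg_closed[of g] g by simp
  then obtain x where x: "x \<in># proots g" using deg by (cases "proots g") (auto simp: d_def)
  \<comment> \<open>This choice gives c s^d = s, which makes H monic, and |c| |s|^(d - 1) = 1, which
    turns \<open>small\<close> into |y - x| <= |s|.\<close>
  obtain s where s: "s ^ (d - 1) = inverse c"
    using nth_root_exists[of "d - 1" "inverse c"] deg by (auto simp: d_def)
  have s0: "s \<noteq> 0" using s c0 deg by (auto simp: d_def power_0_left split: if_splits)
  define h where "h y = (y - x) / s" for y
  define H where "H = (\<Prod>y\<in>#proots g. [:- h y, 1:])"
  have H: "degree H = d" "lead_coeff H = 1"
    using degree_prod_mset_linear[of "image_mset h (proots g)"] szg
      lead_coeff_prod_mset_linear[of "image_mset h (proots g)"]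
    by (simp_all add: H_def image_mset.compositionality o_def)
  have "nrm (h y) \<le> 1" if y: "y \<in># proots g" for y
  proof -
    have "nrm c * nrm (y - x) ^ (d - 1) \<le> 1"
      using small[of y x] x y g0 by (simp add: g_def c_def d_def)
    also have "1 = nrm c * nrm s ^ (d - 1)"
      using s c0 by (simp flip: nrm_power nrm_mult)
    finally have "nrm (y - x) ^ (d - 1) \<le> nrm s ^ (d - 1)" using c0 by simp
    hence "nrm (y - x) \<le> nrm s" using deg by (simp add: power_mono_iff d_def)
    moreover have "nrm (h y) * nrm s = nrm (y - x)" using s0 by (simp add: h_def flip: nrm_mult)
    ultimately have "nrm (h y) * nrm s \<le> 1 * nrm s" by simp
    thus ?thesis by (rule mult_right_le_imp_le) (use s0 in simp)
  qed
  hence H1: "nrm (coeff H k) \<le> 1" for k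
    unfolding H_def by (rule nrm_coeff_prod_mset_linear_le_1)
  have comp: "pcompose (\<Prod>y\<in>#A. [:- y, 1:]) [:x, s:] = smult (s ^ size A) (\<Prod>y\<in>#A. [:- h y, 1:])" for A
  proof (induction A)
    case (add y A)
    have "pcompose [:- y, 1:] [:x, s:] = smult s [:- h y, 1:]"
      using s0 by (simp add: pcompose_pCons h_def)
    hence "pcompose ([:- y, 1:] * (\<Prod>y\<in>#A. [:- y, 1:])) [:x, s:] =
       smult s [:- h y, 1:] * smult (s ^ size A) (\<Prod>y\<in>#A. [:- h y, 1:])"
      unfolding pcompose_mult add by simp
    thus ?case by (simp only: image_mset_add_mset prod_mset.add_mset size_add_mset power_Suc
        mult_smult_left mult_smult_right smult_smult mult.commute)
  qed (simp add: one_pCons)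
  have "g = smult c (\<Prod>y\<in>#proots g. [:- y, 1:])"
    using alg_closed_splits[OF g0] g(2) by simp
  hence "pcompose g [:x, s:] = pcompose (smult c (\<Prod>y\<in>#proots g. [:- y, 1:])) [:x, s:]"
    by (rule arg_cong)
  also have "\<dots> = smult (c * s ^ d) H"
    by (simp add: pcompose_smult comp szg H_def)
  also have "c * s ^ d = s" using s c0 deg by (cases d) (auto simp: d_def)
  finally have "pcompose f [:x, s:] = smult s H - [:- x, - s:]"
    by (simp add: g_def pcompose_add pcompose_pCons eq_diff_eq add.commute)
  hence "pcompose f [:x, s:] - [:x:] = smult s H + (- [:- x, - s:] - [:x:])"
    by (simp only: diff_conv_add_uminus add.assoc)
  also have "- [:- x, - s:] - [:x:] = [:0, s:]" by simp
  also have "smult s H + [:0, s:] = smult s ([:0, 1:] + H)" by (simp add: smult_add_right)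
  finally have "pcompose f [:x, s:] - [:x:] = smult s ([:0, 1:] + H)" .
  moreover have "degree ([:0, 1:] + H) = degree f" "lead_coeff ([:0, 1:] + H) = 1"
    using H deg by (auto simp: d_def degree_add_eq_right coeff_pCons split: nat.split)
  moreover have "nrm (coeff ([:0, 1:] + H) k) \<le> 1" for k
    using H1[of k] nrm_ultrametric[of "coeff [:0, 1:] k" "coeff H k"]
    by (auto simp: coeff_pCons split: nat.splits)
  ultimately show ?thesis using that s0 by blast
qed

end

section \<open>Polynomials under a field embedding\<close>

locale field_embedding =
  fixes emb :: "'a :: field \<Rightarrow> 'b :: field"
  assumes one: "emb 1 = 1"
    and add: "emb (x + y) = emb x + emb y"
    and mult: "emb (x * y) = emb x * emb y"
begin

lemma zero [simp]: "emb 0 = 0"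
  using add[of 0 0] by (metis add.right_neutral add_left_cancel)

lemma minus: "emb (- x) = - emb x" using add[of x "-x"] by (simp add: eq_neg_iff_add_eq_0 add.commute)

lemma diff: "emb (x - y) = emb x - emb y" using add[of x "-y"] by (simp add: minus)

lemma eq_0_iff [simp]: "emb x = 0 \<longleftrightarrow> x = 0"
proof
  assume x: "emb x = 0"
  show "x = 0"
  proof (rule ccontr)
    assume "x \<noteq> 0"
    thus False using mult[of x "inverse x"] x one by simp
  qed
qed simp

lemma eq_iff: "emb x = emb y \<longleftrightarrow> x = y"
  using eq_0_iff[of "x - y"] by (simp add: diff)

lemma of_nat: "emb (of_nat n) = of_nat n"
  by (induction n) (simp_all add: add one)

lemma poly_map_poly: "poly (map_poly emb p) (emb x) = emb (poly p x)"
  by (induction p) (simp_all add: map_poly_pCons add mult)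

lemma pderiv_map_poly: "pderiv (map_poly emb p) = map_poly emb (pderiv p)"
  by (rule poly_eqI) (simp add: coeff_pderiv coeff_map_poly mult of_nat del: of_nat_Suc)

lemma degree_map_poly_embedding: "degree (map_poly emb p) = degree p"
  by (rule degree_map_poly) simp

lemma map_poly_add: "map_poly emb (p + q) = map_poly emb p + map_poly emb q"
  by (rule poly_eqI) (simp add: coeff_map_poly add)

lemma map_poly_diff: "map_poly emb (p - q) = map_poly emb p - map_poly emb q"
  by (rule poly_eqI) (simp add: coeff_map_poly diff)

lemma map_poly_smult_embedding: "map_poly emb (smult c p) = smult (emb c) (map_poly emb p)"
  by (rule poly_eqI) (simp add: coeff_map_poly mult)

lemma map_poly_mult: "map_poly emb (p * q) = map_poly emb p * map_poly emb q"
proof (induction p)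
  case (pCons a p)
  thus ?case by (simp add: map_poly_add map_poly_smult_embedding map_poly_pCons)
qed simp

lemma map_poly_pcompose: "map_poly emb (pcompose p q) = pcompose (map_poly emb p) (map_poly emb q)"
  by (induction p) (simp_all add: pcompose_pCons map_poly_pCons map_poly_add map_poly_mult)

end

section \<open>Reduction and good reduction over the completion\<close>

context laurent_alg_closure_completion
begin

sublocale emb: field_embedding emb
  by unfold_locales (rule emb_1 emb_add emb_mult)+

text \<open>Positive integers are nonzero constant series, of subdegree 0. This makes the root
  counting available on the algebraic closure.\<close>

lemma nrm_emb_residue_char_0_abs: "residue_char_0_abs (\<lambda>x. nrm (emb x))"
proof
  fix k :: nat assume "k > 0"
  moreover have "nrm (emb (of_nat k)) = fls_abs (of_nat k)"
    using nrm_extends[of "of_nat k"] by simp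
  ultimately show "nrm (emb (of_nat k)) = 1" by (simp add: fls_abs_def fls_of_nat)
qed (auto simp: nrm_nonneg nrm_eq_0_iff emb_mult nrm_mult emb_add nrm_ultrametric)

text \<open>Distinct constants differ by a nonzero constant, of norm 1, so c is the only constant at
  distance below 1.\<close>

lemma reduction_const: "reduction nrm emb (emb (to_ac (fls_const c))) = c"
proof -
  have eq: "nrm (emb (to_ac (fls_const c)) - emb (to_ac (fls_const b))) = (if b = c then 0 else 1)" for b
  proof -
    have "emb (to_ac (fls_const c)) - emb (to_ac (fls_const b)) = emb (to_ac (fls_const (c - b)))"
      by (simp add: fls_minus_const flip: emb.diff to_ac_diff)
    thus ?thesis by (simp add: nrm_extends fls_abs_def)
  qed
  show ?thesis unfolding reduction_def eq by (rule the_equality) (auto split: if_splits)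
qed

lemma reduction_0 [simp]: "reduction nrm emb 0 = 0"
  using reduction_const[of 0] by simp

lemma reduction_1 [simp]: "reduction nrm emb 1 = 1"
  using reduction_const[of 1] by (simp add: emb_1)

lemma form_subst_affine:
  assumes "degree P \<le> d"
  shows "form_subst d a b 0 1 P = pcompose P [:b, a:]"
proof -
  have "form_subst d a b 0 1 P = (\<Sum>i\<le>d. smult (coeff P i) ([:b, a:] ^ i))"
    by (simp add: form_subst_def flip: one_pCons)
  also have "\<dots> = (\<Sum>i\<le>degree P. smult (coeff P i) ([:b, a:] ^ i))"
    using assms by (intro sum.mono_neutral_right) (auto simp: coeff_eq_0)
  also have "\<dots> = pcompose P [:b, a:]"
    by (simp add: pcompose_altdef poly_altdef coeff_map_poly degree_map_poly)
  finally show ?thesis .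
qed

text \<open>Scaling by 1 / s turns the pair into [F : 1]. The reductions of 0 and 1 suffice: they
  fix the degree of the reduced F, and the reduced second component 1 is coprime to
  everything.\<close>

lemma good_reduction_monic:
  assumes F: "degree F = d" "d > 0" "lead_coeff F = 1" "\<And>k. nrm (coeff F k) \<le> 1" and s: "s \<noteq> 0"
  shows "good_reduction nrm emb d (smult s F) [:s:]"
proof -
  have one: "nrm 1 = 1" using nrm_extends[of 1] by (simp add: emb_1 fls_abs_def)
  have cop: "coprime p [:c:]" if "c \<noteq> 0" for p :: "'b :: field poly" and c
    using that by (intro is_unit_right_imp_coprime) (simp add: is_unit_const_poly_iff dvd_field_iff)
  have "Max (nrm ` (range (coeff F) \<union> range (coeff 1))) = 1"
  proof (rule Max_eqI)
    have fin: "finite (range (coeff p))" for p :: "'l poly"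
    proof -
      have "coeff p k \<in> insert 0 (coeff p ` {..degree p})" for k
        by (cases "k \<le> degree p") (auto simp: coeff_eq_0)
      hence "range (coeff p) \<subseteq> insert 0 (coeff p ` {..degree p})" by blast
      thus ?thesis by (rule finite_subset) simp
    qed
    show "finite (nrm ` (range (coeff F) \<union> range (coeff 1)))"
      by (intro finite_imageI finite_UnI fin)
    show "1 \<in> nrm ` (range (coeff F) \<union> range (coeff 1))"
      using F(3) one by (intro image_eqI[of _ _ "lead_coeff F"]) auto
    show "y \<le> 1" if "y \<in> nrm ` (range (coeff F) \<union> range (coeff 1))" for y
      using that F(4) one nrm_eq_0_iff[of 0] by (auto simp: coeff_1)
  qed
  hence "max_coeff_norm nrm (smult (inverse s) (smult s F)) (smult (inverse s) [:s:]) = 1"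
    using s by (simp add: max_coeff_norm_def flip: one_pCons)
  moreover have "degree (map_poly (reduction nrm emb) F) = d"
  proof (rule antisym)
    show "degree (map_poly (reduction nrm emb) F) \<le> d"
      using F(1) by (intro degree_le) (simp add: coeff_map_poly coeff_eq_0)
    show "d \<le> degree (map_poly (reduction nrm emb) F)"
      using F(1,3) by (intro le_degree) (simp add: coeff_map_poly)
  qed
  hence "rational_map d (map_poly (reduction nrm emb) (smult (inverse s) (smult s F)))
           (map_poly (reduction nrm emb) (smult (inverse s) [:s:]))"
    using s cop[of 1] by (simp add: rational_map_def map_poly_pCons)
  moreover have "rational_map d (smult s F) [:s:]"
    using s F cop[of s] by (simp add: rational_map_def)
  ultimately show ?thesis unfolding good_reduction_def using s
    by (intro conjI exI[of _ "inverse s"]) auto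
qed

lemma potential_good_reduction_if_fixed_points_close:
  assumes deg: "degree f = d" "d \<ge> 2"
    and small: "\<And>x y. poly f x = x \<Longrightarrow> poly f y = y \<Longrightarrow>
                  nrm (emb (lead_coeff f)) * nrm (emb (x - y)) ^ (d - 1) \<le> 1"
  shows "potential_good_reduction nrm emb d (map_poly emb f) 1"
proof -
  interpret N: residue_char_0_abs "\<lambda>x. nrm (emb x)" by (rule nrm_emb_residue_char_0_abs)
  obtain s x F where F: "s \<noteq> 0" "pcompose f [:x, s:] - [:x:] = smult s F"
    "degree F = degree f" "lead_coeff F = 1" "\<And>k. nrm (emb (coeff F k)) \<le> 1"
    by (rule N.integral_conjugate[of f, unfolded deg(1), OF deg(2) small[unfolded deg(1)]]) (auto simp: deg(1))
  have "good_reduction nrm emb d (smult (emb s) (map_poly emb F)) [:emb s:]"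
    using F deg by (intro good_reduction_monic) (auto simp: emb.degree_map_poly_embedding coeff_map_poly emb_1)
  \<comment> \<open>The matrix with rows (s, x) and (0, 1) represents x + s X and has determinant s;
    the conjugated pair is [s F : s].\<close>
  moreover have "conj_num d (emb s) (emb x) 0 1 (map_poly emb f) 1 = smult (emb s) (map_poly emb F)"
  proof -
    have "conj_num d (emb s) (emb x) 0 1 (map_poly emb f) 1 = map_poly emb (pcompose f [:x, s:] - [:x:])"
      using deg by (simp add: conj_num_def form_subst_affine emb.degree_map_poly_embedding emb.map_poly_diff
          emb.map_poly_pcompose map_poly_pCons one_pCons)
    thus ?thesis using F(2) by (simp add: emb.map_poly_smult_embedding)
  qed
  moreover have "conj_den d (emb s) (emb x) 0 1 (map_poly emb f) 1 = [:emb s:]"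
    by (simp add: conj_den_def form_subst_affine one_pCons)
  ultimately show ?thesis unfolding potential_good_reduction_def using F(1)
    by (intro exI[of _ "emb s"] exI[of _ "emb x"] exI[of _ 0] exI[of _ 1]) simp
qed

section \<open>Transfer of repelling points to the completion\<close>

lemma repelling_fixed_point_emb:
  assumes "poly f w = w" "nrm (emb (poly (pderiv f) w)) > 1"
  shows "repelling_periodic_point nrm (map_poly emb f) 1 (emb w)"
  using assms by (auto simp: repelling_periodic_point_def periodic_point_def multiplier_def poly_iter_def
      emb.poly_map_poly emb.pderiv_map_poly pcompose_idR)

lemma repelling_2_periodic_point_emb:
  assumes "poly f (poly f w) = w" "poly f w \<noteq> w"
    "nrm (emb (poly (pderiv f) (poly f w) * poly (pderiv f) w)) > 1"
  shows "repelling_periodic_point nrm (map_poly emb f) 2 (emb w)"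
proof -
  have "(poly (map_poly emb f) ^^ m) (emb w) \<noteq> emb w" if "0 < m" "m < 2" for m
  proof -
    have "m = 1" using that by simp
    thus ?thesis using assms(2) by (simp add: emb.poly_map_poly emb.eq_iff)
  qed
  hence "periodic_point (map_poly emb f) 2 (emb w)"
    using assms(1) by (simp add: periodic_point_def emb.poly_map_poly numeral_2_eq_2)
  moreover have "multiplier (map_poly emb f) 2 (emb w) =
      emb (poly (pderiv f) (poly f w) * poly (pderiv f) w)"
    by (simp add: multiplier_def poly_iter_def numeral_2_eq_2 pcompose_idR pderiv_pcompose poly_pcompose
        emb.poly_map_poly emb.pderiv_map_poly emb_mult)
  ultimately show ?thesis using assms(3) by (simp add: repelling_periodic_point_def)
qed

end

theorem theorem3p1:
  fixes nrm :: "'l :: field \<Rightarrow> real"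
    and emb :: "complex fls alg_closure \<Rightarrow> 'l"
    and f :: "complex fls poly"
    and d :: nat
  assumes "laurent_alg_closure_completion nrm emb"
    and "degree f = d" and "d \<ge> 2"
    and "\<not> potential_good_reduction nrm emb d (base_change emb f) 1"
  shows "(\<exists>n z. n \<le> 2 \<and> repelling_periodic_point nrm (base_change emb f) n z) \<and>
         (d \<in> {2, 3} \<longrightarrow> (\<exists>z. repelling_periodic_point nrm (base_change emb f) 1 z))"
proof -
  interpret laurent_alg_closure_completion nrm emb by fact
  interpret N: residue_char_0_abs "\<lambda>x. nrm (emb x)" by (rule nrm_emb_residue_char_0_abs)
  define g where "g = map_poly to_ac f"
  have bc: "base_change emb f = map_poly emb g"
    by (simp add: base_change_def g_def map_poly_map_poly o_def)
  have deg: "degree g = d" using assms(2) by (simp add: g_def degree_map_poly)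
  have "\<not> (\<forall>x y. poly g x = x \<longrightarrow> poly g y = y \<longrightarrow>
      nrm (emb (lead_coeff g)) * nrm (emb (x - y)) ^ (d - 1) \<le> 1)"
    using potential_good_reduction_if_fixed_points_close[OF deg assms(3)] assms(4) unfolding bc by blast
  then obtain x y where fp: "poly g x = x" "poly g y = y"
    and large: "nrm (emb (lead_coeff g)) * nrm (emb (x - y)) ^ (degree g - 1) > 1"
    unfolding deg not_all not_imp not_le by blast
  \<comment> \<open>For x = y the power would be 0, since the exponent is positive.\<close>
  have ne: "x \<noteq> y" using large deg assms(3) by (auto simp: power_0_left nrm_eq_0_iff[THEN iffD2, OF refl])
  have pos: "degree g > 0" using deg assms(3) by simp
  have "\<exists>n z. n \<le> 2 \<and> repelling_periodic_point nrm (map_poly emb g) n z"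
    using N.repelling_point_of_period_le_2[OF pos ne fp large]
  proof (elim disjE exE conjE)
    fix w assume "poly g w = w" "nrm (emb (poly (pderiv g) w)) > 1"
    thus ?thesis using repelling_fixed_point_emb[of g w] by (intro exI[of _ 1] exI[of _ "emb w"]) simp
  next
    fix w assume "poly g (poly g w) = w" "poly g w \<noteq> w"
      "nrm (emb (poly (pderiv g) (poly g w) * poly (pderiv g) w)) > 1"
    thus ?thesis using repelling_2_periodic_point_emb[of g w] by (intro exI[of _ 2] exI[of _ "emb w"]) simp
  qed
  moreover have "\<exists>z. repelling_periodic_point nrm (map_poly emb g) 1 z" if "d \<in> {2, 3}"
  proof -
    have deg23: "degree g \<in> {2, 3}" using that deg by simp
    obtain w where "poly g w = w" "nrm (emb (poly (pderiv g) w)) > 1"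
      by (rule N.repelling_fixed_point_degree_le_3[OF deg23 ne fp large])
    thus ?thesis using repelling_fixed_point_emb[of g w] by blast
  qed
  ultimately show ?thesis unfolding bc by blast
qed

end
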